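(* For any property $\mathcal{P}$ (a set of finite graphs), the following are equivalent: (A) $\mathcal{P}$ is additive and induced-hereditary; (B) $\mathcal{P}$ has a generating set, and moreover, for any graph $L\in\mathcal{P}$ and any generating set $\mathcal{G}$ of $\mathcal{P}$, the set $\mathcal{G}[2L]$ is also a generating set; (C) $\mathcal{P}$ has an infinite ordered generating set $H_1\le H_2\le\cdots$ such that $2H_i\le H_{i+1}$ for all $i$; (D) $\mathcal{P}$ has a generating graph $H$ such that $2H\le H$; and moreover, for any generating graph $G$ of $\mathcal{P}$ there is a generating graph $H\ge G$ of $\mathcal{P}$ with $2H\le H$.
   Context: Graphs in properties are finite, simple and unlabelled; generating graphs may be infinite. $G\le H$ means $G$ is (isomorphic to) an induced subgraph of $H$. A property is induced-hereditary if closed under induced subgraphs and additive if closed under disjoint unions. $kG$ denotes the disjoint union of $k$ copies of $G$. A generating set for $\mathcal{P}$ is a set $\mathcal{G}\subseteq\mathcal{P}$ such that every graph in $\mathcal{P}$ is an induced subgraph of some member of $\mathcal{G}$; it is ordered if its elements can be listed as $H_1\le H_2\le\cdots$. A generating graph for $\mathcal{P}$ is a (finite or infinite) graph $H$ such that $\mathcal{P}=\{G\mid G\le H,\ |V(G)|\text{ finite}\}$. For a set $\mathcal{G}$ of graphs and a graph $L$, $\mathcal{G}[2L]=\{G\in\mathcal{G}\mid 2L\le G\}$.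
   Formalization: A generating set must also generate only graphs of P (else P = {nK_2 : n ≥ 1} satisfies (B) and (C) but not (A)), and P must contain a graph with a vertex (else P empty or P = {K_0} satisfies (A) but not (C)); generating graphs have vertices in an arbitrary fixed infinite set. *)

theory Defs
  imports Main
begin

record 'a ugraph =
  verts :: "'a set"
  edges :: "'a set set"

definition simple_graph :: "'a ugraph \<Rightarrow> bool" where
  "simple_graph G \<longleftrightarrow> (\<forall>e\<in>edges G. e \<subseteq> verts G \<and> card e = 2)"

definition graph_iso :: "'a ugraph \<Rightarrow> 'b ugraph \<Rightarrow> bool"  (infix "\<cong>\<^sub>g" 50) where
  "G \<cong>\<^sub>g H \<longleftrightarrow> (\<exists>f. bij_betw f (verts G) (verts H) \<and> edges H = (\<lambda>e. f ` e) ` edges G)"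

definition induce :: "'a ugraph \<Rightarrow> 'a set \<Rightarrow> 'a ugraph" where
  "induce H W = \<lparr>verts = W, edges = {e \<in> edges H. e \<subseteq> W}\<rparr>"

definition induced_le :: "'a ugraph \<Rightarrow> 'b ugraph \<Rightarrow> bool"  (infix "\<le>\<^sub>g" 50) where
  "G \<le>\<^sub>g H \<longleftrightarrow> (\<exists>W\<subseteq>verts H. G \<cong>\<^sub>g induce H W)"

definition disjoint_union :: "'a ugraph \<Rightarrow> 'b ugraph \<Rightarrow> ('a + 'b) ugraph" where
  "disjoint_union G H =
    \<lparr>verts = verts G <+> verts H,
     edges = (\<lambda>e. Inl ` e) ` edges G \<union> (\<lambda>e. Inr ` e) ` edges H\<rparr>"

definition copies :: "nat \<Rightarrow> 'a ugraph \<Rightarrow> (nat \<times> 'a) ugraph" where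
  "copies k G =
    \<lparr>verts = {..<k} \<times> verts G, edges = (\<Union>i<k. (\<lambda>e. Pair i ` e) ` edges G)\<rparr>"

text \<open>
  Every finite graph is isomorphic to one whose vertices are natural numbers. A set of finite
  unlabelled graphs is represented by a set of such graphs: a property by the
  isomorphism-closed set of all its labelled versions, a generating set by any set of
  labelled representatives. The graph without vertices is allowed.
\<close>

definition fin_graphs :: "nat ugraph set" where
  "fin_graphs = {G. simple_graph G \<and> finite (verts G)}"

definition graph_property :: "nat ugraph set \<Rightarrow> bool" where
  "graph_property P \<longleftrightarrow>
    P \<subseteq> fin_graphs \<and> (\<forall>G\<in>P. \<forall>K\<in>fin_graphs. K \<cong>\<^sub>g G \<longrightarrow> K \<in> P)"

definition induced_hereditary :: "nat ugraph set \<Rightarrow> bool" where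
  "induced_hereditary P \<longleftrightarrow> (\<forall>H\<in>P. \<forall>G\<in>fin_graphs. G \<le>\<^sub>g H \<longrightarrow> G \<in> P)"

definition additive :: "nat ugraph set \<Rightarrow> bool" where
  "additive P \<longleftrightarrow>
    (\<forall>G\<in>P. \<forall>H\<in>P. \<forall>K\<in>fin_graphs. K \<cong>\<^sub>g disjoint_union G H \<longrightarrow> K \<in> P)"

text \<open>
  The last conjunct says that a generating set generates nothing outside the property, as in
  the definition of a generating graph below. Without it every set of graphs would be a
  generating set of itself, and possessing one could not entail being induced-hereditary:
  the disjoint unions of one or more copies of \<open>K\<^sub>2\<close> would be a counterexample.
\<close>

definition generating_set :: "nat ugraph set \<Rightarrow> nat ugraph set \<Rightarrow> bool" where
  "generating_set P \<G> \<longleftrightarrow>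
    \<G> \<subseteq> P \<and> (\<forall>G\<in>P. \<exists>H\<in>\<G>. G \<le>\<^sub>g H) \<and>
    (\<forall>H\<in>\<G>. \<forall>G\<in>fin_graphs. G \<le>\<^sub>g H \<longrightarrow> G \<in> P)"

definition generating_graph :: "nat ugraph set \<Rightarrow> 'a ugraph \<Rightarrow> bool" where
  "generating_graph P H \<longleftrightarrow> simple_graph H \<and> P = {G \<in> fin_graphs. G \<le>\<^sub>g H}"

definition containing_two :: "nat ugraph set \<Rightarrow> nat ugraph \<Rightarrow> nat ugraph set" where
  "containing_two \<G> L = {G \<in> \<G>. copies 2 L \<le>\<^sub>g G}"

text \<open>The unlabelled graphs represented by a set of labelled ones.\<close>

definition iso_types :: "nat ugraph set \<Rightarrow> nat ugraph set set" where
  "iso_types \<G> = (\<lambda>G. {K \<in> fin_graphs. K \<cong>\<^sub>g G}) ` \<G>"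

end

theory Submission
  imports Defs "HOL-Library.Countable_Set"
begin

text \<open>
  For an additive, induced-hereditary property \<open>P\<close>, a finite induced subgraph of a disjoint union
  of graphs lies in \<open>P\<close> as soon as its intersections with the individual summands do. So the
  disjoint union of countably many copies of a generating graph \<open>G\<close> is again generating, and it
  absorbs its own double; enumerating \<open>P\<close> (it is countable) and repeatedly doubling while adding the
  next graph gives the ordered generating set. Conversely, each of (B), (C), (D) places any two
  members of \<open>P\<close> inside one graph \<open>H\<close> for which \<open>2H\<close> is still contained in a generator.
\<close>

section \<open>Induced subgraphs as injections that preserve and reflect adjacency\<close>

definition embeds :: "('a \<Rightarrow> 'b) \<Rightarrow> 'a ugraph \<Rightarrow> 'b ugraph \<Rightarrow> bool" where
  "embeds f G H \<longleftrightarrow> inj_on f (verts G) \<and> f ` verts G \<subseteq> verts H \<and>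
    (\<forall>x\<in>verts G. \<forall>y\<in>verts G. {x, y} \<in> edges G \<longleftrightarrow> {f x, f y} \<in> edges H)"

lemma simple_graph_edge:
  assumes "simple_graph G" "e \<in> edges G"
  obtains x y where "e = {x, y}" "x \<noteq> y" "x \<in> verts G" "y \<in> verts G"
  using assms unfolding simple_graph_def by (metis card_2_iff insert_subset)

text \<open>Adjacency is compared pair by pair in \<open>embeds\<close>, whereas
  \<open>graph_iso\<close> compares whole edge sets. The two views agree because every edge of a
  simple graph is a pair of vertices.\<close>

lemma embeds_imp_edges_image:
  assumes f: "embeds f G H" and G: "simple_graph G" and H: "simple_graph H"
  shows "{e \<in> edges H. e \<subseteq> f ` verts G} = (\<lambda>e. f ` e) ` edges G"
proof (intro equalityI subsetI)
  fix e assume e: "e \<in> {e \<in> edges H. e \<subseteq> f ` verts G}"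
  then obtain a b where ab: "e = {a, b}" using H by (auto elim: simple_graph_edge)
  with e obtain x y where "x \<in> verts G" "y \<in> verts G" "a = f x" "b = f y" by auto
  then show "e \<in> (\<lambda>e. f ` e) ` edges G"
    using f e ab unfolding embeds_def by (intro image_eqI[of _ _ "{x, y}"]) auto
next
  fix e assume "e \<in> (\<lambda>e. f ` e) ` edges G"
  then obtain d where d: "d \<in> edges G" "e = f ` d" by auto
  with G obtain x y where "d = {x, y}" "x \<in> verts G" "y \<in> verts G"
    by (auto elim: simple_graph_edge)
  with d f show "e \<in> {e \<in> edges H. e \<subseteq> f ` verts G}" unfolding embeds_def by auto
qed

text \<open>With \<open>embeds\<close> there is no vertex subset \<open>W\<close> to carry along:
  most later comparisons come down to giving an explicit vertex map, and transitivity is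
  composition.\<close>

lemma induced_le_iff_embeds:
  assumes G: "simple_graph G" and H: "simple_graph H"
  shows "G \<le>\<^sub>g H \<longleftrightarrow> (\<exists>f. embeds f G H)"
proof
  assume "G \<le>\<^sub>g H"
  then obtain W f where W: "W \<subseteq> verts H" and f: "bij_betw f (verts G) W"
    and E: "{e \<in> edges H. e \<subseteq> W} = (\<lambda>e. f ` e) ` edges G"
    unfolding induced_le_def graph_iso_def induce_def by auto
  have inj: "inj_on f (verts G)" and im: "f ` verts G = W" using f by (auto simp: bij_betw_def)
  have "{x, y} \<in> edges G \<longleftrightarrow> {f x, f y} \<in> edges H" if xy: "x \<in> verts G" "y \<in> verts G" for x y
  proof
    assume "{x, y} \<in> edges G"
    then have "f ` {x, y} \<in> {e \<in> edges H. e \<subseteq> W}" unfolding E by blast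
    then show "{f x, f y} \<in> edges H" by simp
  next
    assume "{f x, f y} \<in> edges H"
    then have "f ` {x, y} \<in> (\<lambda>e. f ` e) ` edges G" using xy im unfolding E[symmetric] by auto
    then obtain d where d: "d \<in> edges G" "f ` {x, y} = f ` d" by auto
    \<comment> \<open>Both sets lie within \<open>verts G\<close>, where \<open>f\<close> is
      injective, so equal images force equal sets.\<close>
    then have "{x, y} = d"
      using G xy inj_on_image_eq_iff[OF inj, of "{x, y}" d] by (auto simp: simple_graph_def)
    with d show "{x, y} \<in> edges G" by simp
  qed
  with inj im W show "\<exists>f. embeds f G H" unfolding embeds_def by blast
next
  assume "\<exists>f. embeds f G H"
  then obtain f where f: "embeds f G H" by auto
  then have "bij_betw f (verts G) (f ` verts G)" "f ` verts G \<subseteq> verts H"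
    by (auto simp: embeds_def bij_betw_def)
  with embeds_imp_edges_image[OF f G H] show "G \<le>\<^sub>g H"
    unfolding induced_le_def graph_iso_def induce_def by auto
qed

lemma graph_isoI_embeds:
  assumes f: "embeds f G H" "f ` verts G = verts H" and G: "simple_graph G" and H: "simple_graph H"
  shows "G \<cong>\<^sub>g H"
proof -
  have "{e \<in> edges H. e \<subseteq> verts H} = edges H" using H by (auto simp: simple_graph_def)
  then show ?thesis
    using embeds_imp_edges_image[OF f(1) G H] f unfolding graph_iso_def embeds_def bij_betw_def
    by auto
qed

lemma graph_iso_imp_induced_le:
  assumes "G \<cong>\<^sub>g H" "simple_graph H"
  shows "G \<le>\<^sub>g H"
proof -
  have "{e \<in> edges H. e \<subseteq> verts H} = edges H" using assms by (auto simp: simple_graph_def)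
  then have "induce H (verts H) = H" by (simp add: induce_def)
  then show ?thesis using assms(1) unfolding induced_le_def by (intro exI[of _ "verts H"]) simp
qed

lemma graph_iso_refl: "G \<cong>\<^sub>g G"
  unfolding graph_iso_def by (rule exI[of _ id]) auto

lemma induced_le_refl: "simple_graph G \<Longrightarrow> G \<le>\<^sub>g G"
  by (simp add: graph_iso_imp_induced_le graph_iso_refl)

lemma graph_iso_card: "G \<cong>\<^sub>g H \<Longrightarrow> card (verts G) = card (verts H)"
  by (auto simp: graph_iso_def bij_betw_same_card)

lemma embeds_comp: "embeds f G H \<Longrightarrow> embeds g H K \<Longrightarrow> embeds (g \<circ> f) G K"
  unfolding embeds_def by (auto intro!: comp_inj_on elim: inj_on_subset simp: image_subset_iff)

lemma induced_le_trans:
  assumes "G \<le>\<^sub>g H" "H \<le>\<^sub>g K" "simple_graph G" "simple_graph H" "simple_graph K"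
  shows "G \<le>\<^sub>g K"
  using assms embeds_comp by (metis induced_le_iff_embeds)

lemma induced_le_card:
  assumes "G \<le>\<^sub>g H" "simple_graph G" "simple_graph H" "finite (verts H)"
  shows "card (verts G) \<le> card (verts H)"
  using assms by (auto simp: induced_le_iff_embeds embeds_def intro: card_inj_on_le)

section \<open>Moving graphs to another vertex type\<close>

definition relabel :: "('a \<Rightarrow> 'b) \<Rightarrow> 'a ugraph \<Rightarrow> 'b ugraph" where
  "relabel f G = \<lparr>verts = f ` verts G, edges = (\<lambda>e. f ` e) ` edges G\<rparr>"

lemma simple_relabel:
  assumes "simple_graph G" "inj_on f (verts G)"
  shows "simple_graph (relabel f G)"
  using assms unfolding simple_graph_def relabel_def
  by (auto simp: card_image inj_on_subset)

lemma relabel_iso: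
  assumes G: "simple_graph G" and f: "inj_on f (verts G)"
  shows "G \<cong>\<^sub>g relabel f G" "relabel f G \<cong>\<^sub>g G"
proof -
  show "G \<cong>\<^sub>g relabel f G"
    using f unfolding graph_iso_def relabel_def by (auto simp: bij_betw_def)
  have "inv_into (verts G) f ` (f ` e) = e" if "e \<in> edges G" for e
    using G f that by (auto simp: simple_graph_def inv_into_image_cancel)
  then have "(\<lambda>e. inv_into (verts G) f ` e) ` (\<lambda>e. f ` e) ` edges G = edges G"
    by (simp add: image_image)
  moreover have "bij_betw (inv_into (verts G) f) (f ` verts G) (verts G)"
    using f by (simp add: bij_betw_inv_into inj_on_imp_bij_betw)
  ultimately show "relabel f G \<cong>\<^sub>g G"
    unfolding graph_iso_def relabel_def by (intro exI[of _ "inv_into (verts G) f"]) simp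
qed

text \<open>Properties contain only graphs on \<open>nat\<close>, whereas
  \<open>disjoint_union\<close> changes the vertex type. Passing to an isomorphic copy on
  \<open>nat\<close> makes \<open>additive\<close> applicable to an actual union.\<close>

lemma finite_graph_on_nat:
  assumes G: "simple_graph G" and fin: "finite (verts G)"
  obtains K where "K \<in> fin_graphs" "K \<cong>\<^sub>g G" "G \<cong>\<^sub>g K"
proof -
  obtain f :: "'a \<Rightarrow> nat" where f: "inj_on f (verts G)"
    using finite_imp_inj_to_nat_seg[OF fin] by auto
  have "relabel f G \<in> fin_graphs"
    using simple_relabel[OF G f] fin by (auto simp: fin_graphs_def relabel_def)
  then show thesis using that relabel_iso[OF G f] by blast
qed

section \<open>Disjoint unions, families and copies\<close>

lemma simple_disjoint_union:
  assumes "simple_graph G" "simple_graph H"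
  shows "simple_graph (disjoint_union G H)"
  using assms unfolding simple_graph_def disjoint_union_def
  by (auto simp: card_image inj_on_def)

lemma verts_disjoint_union: "verts (disjoint_union G H) = verts G <+> verts H"
  by (simp add: disjoint_union_def)

lemma edges_disjoint_union_iff [simp]:
  "{Inl a, Inl b} \<in> edges (disjoint_union G H) \<longleftrightarrow> {a, b} \<in> edges G"
  "{Inr c, Inr d} \<in> edges (disjoint_union G H) \<longleftrightarrow> {c, d} \<in> edges H"
  "{Inl a, Inr d} \<notin> edges (disjoint_union G H)"
  "{Inr d, Inl a} \<notin> edges (disjoint_union G H)"
proof -
  have l: "{Inl a :: 'a + 'b, Inl b} = Inl ` e \<longleftrightarrow> e = {a, b}" for e :: "'a set" and a b
    using inj_image_eq_iff[OF inj_Inl, of "{a, b}" e] by auto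
  have r: "{Inr a :: 'a + 'b, Inr b} = Inr ` e \<longleftrightarrow> e = {a, b}" for e :: "'b set" and a b
    using inj_image_eq_iff[OF inj_Inr, of "{a, b}" e] by auto
  have n: "{Inl a, z} \<noteq> Inr ` e" "{z, Inl a} \<noteq> Inr ` e"
    "{Inr d, z} \<noteq> Inl ` e'" "{z, Inr d} \<noteq> Inl ` e'"
    for z :: "'a + 'b" and e :: "'b set" and e' :: "'a set" and a d
    by blast+
  show "{Inl a, Inl b} \<in> edges (disjoint_union G H) \<longleftrightarrow> {a, b} \<in> edges G"
    "{Inr c, Inr d} \<in> edges (disjoint_union G H) \<longleftrightarrow> {c, d} \<in> edges H"
    "{Inl a, Inr d} \<notin> edges (disjoint_union G H)"
    "{Inr d, Inl a} \<notin> edges (disjoint_union G H)"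
    unfolding disjoint_union_def by (simp_all add: image_iff l r n)
qed

text \<open>Tagging each vertex with its index keeps the summands apart for infinite
  \<open>I\<close> too, so finite copies and countable unions share one theory.\<close>

definition family_union :: "'i set \<Rightarrow> ('i \<Rightarrow> 'a ugraph) \<Rightarrow> ('i \<times> 'a) ugraph" where
  "family_union I F = \<lparr>verts = Sigma I (\<lambda>i. verts (F i)),
    edges = (\<Union>i\<in>I. (\<lambda>e. Pair i ` e) ` edges (F i))\<rparr>"

lemma copies_eq_family_union: "copies k G = family_union {..<k} (\<lambda>_. G)"
  by (simp add: copies_def family_union_def)

lemma verts_family_union [simp]:
  "p \<in> verts (family_union I F) \<longleftrightarrow> fst p \<in> I \<and> snd p \<in> verts (F (fst p))"
  by (cases p) (simp add: family_union_def)

lemma edges_family_union_iff [simp]: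
  "{p, q} \<in> edges (family_union I F) \<longleftrightarrow>
    fst p \<in> I \<and> fst p = fst q \<and> {snd p, snd q} \<in> edges (F (fst p))"
proof -
  have *: "{p, q} = Pair i ` e \<longleftrightarrow> fst p = i \<and> fst q = i \<and> e = {snd p, snd q}" for i and e :: "'b set"
  proof
    assume eq: "{p, q} = Pair i ` e"
    \<comment> \<open>The second projection undoes \<open>Pair i\<close>, so the image determines
      \<open>e\<close>.\<close>
    then have "snd ` {p, q} = e" by (simp add: image_image)
    moreover have "p \<in> Pair i ` e" "q \<in> Pair i ` e" using eq by auto
    ultimately show "fst p = i \<and> fst q = i \<and> e = {snd p, snd q}" by auto
  qed (cases p; cases q; auto)
  then show ?thesis unfolding family_union_def by (simp add: image_iff *) metis
qed

lemma simple_family_union: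
  assumes "\<And>i. i \<in> I \<Longrightarrow> simple_graph (F i)"
  shows "simple_graph (family_union I F)"
  using assms unfolding simple_graph_def family_union_def
  by (auto simp: card_image inj_on_def)

lemma simple_copies: "simple_graph G \<Longrightarrow> simple_graph (copies k G)"
  by (simp add: copies_eq_family_union simple_family_union)

lemma member_le_family_union:
  assumes "i \<in> I" "\<And>i. i \<in> I \<Longrightarrow> simple_graph (F i)"
  shows "F i \<le>\<^sub>g family_union I F"
proof -
  have "embeds (Pair i) (F i) (family_union I F)"
    using assms by (auto simp: embeds_def inj_on_def)
  then show ?thesis using assms simple_family_union[of I F] by (auto simp: induced_le_iff_embeds)
qed

lemma le_copies: "simple_graph G \<Longrightarrow> 0 < k \<Longrightarrow> G \<le>\<^sub>g copies k G"
  unfolding copies_eq_family_union by (rule member_le_family_union) auto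

lemma copies_mono:
  assumes "G \<le>\<^sub>g H" and G: "simple_graph G" and H: "simple_graph H"
  shows "copies k G \<le>\<^sub>g copies k H"
proof -
  obtain f where "embeds f G H" using assms by (auto simp: induced_le_iff_embeds)
  then have "embeds (map_prod id f) (copies k G) (copies k H)"
    unfolding embeds_def copies_eq_family_union by (auto simp: inj_on_def image_subset_iff)
  then show ?thesis using simple_copies[OF G] simple_copies[OF H] by (auto simp: induced_le_iff_embeds)
qed

text \<open>\<open>G\<close> and \<open>H\<close> may overlap inside \<open>K\<close>; sending one
  to copy 0 and the other to copy 1 separates them.\<close>

lemma disjoint_union_le_copies:
  assumes "G \<le>\<^sub>g K" "H \<le>\<^sub>g K" and G: "simple_graph G" and H: "simple_graph H"
    and K: "simple_graph K"
  shows "disjoint_union G H \<le>\<^sub>g copies 2 K"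
proof -
  obtain f g where "embeds f G K" "embeds g H K" using assms by (auto simp: induced_le_iff_embeds)
  then have "embeds (case_sum (\<lambda>x. (0, f x)) (\<lambda>y. (1, g y))) (disjoint_union G H) (copies 2 K)"
    unfolding embeds_def copies_eq_family_union verts_disjoint_union
    by (auto simp: inj_on_def image_subset_iff Plus_def ball_Un)
  then show ?thesis
    using simple_copies[OF K] simple_disjoint_union[OF G H] by (auto simp: induced_le_iff_embeds)
qed

lemma summands_le_disjoint_union:
  assumes G: "simple_graph G" and H: "simple_graph H"
  shows "G \<le>\<^sub>g disjoint_union G H" "H \<le>\<^sub>g disjoint_union G H"
proof -
  have "embeds Inl G (disjoint_union G H)" "embeds Inr H (disjoint_union G H)"
    by (auto simp: embeds_def verts_disjoint_union)
  then show "G \<le>\<^sub>g disjoint_union G H" "H \<le>\<^sub>g disjoint_union G H"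
    using simple_disjoint_union[OF G H] G H by (auto simp: induced_le_iff_embeds)
qed

lemma copies_2_le_disjoint_union:
  assumes G: "simple_graph G"
  shows "copies 2 G \<le>\<^sub>g disjoint_union G G"
proof -
  have "embeds (\<lambda>(i, x). if i = 0 then Inl x else Inr x) (copies 2 G) (disjoint_union G G)"
    unfolding embeds_def copies_eq_family_union
    by (auto simp: inj_on_def verts_disjoint_union less_2_cases_iff)
  then show ?thesis
    using simple_copies[OF G] simple_disjoint_union[OF G G] by (auto simp: induced_le_iff_embeds)
qed

section \<open>Finite induced subgraphs of unions, and generating graphs built from them\<close>

lemma simple_induce: "simple_graph G \<Longrightarrow> simple_graph (induce G W)"
  by (auto simp: simple_graph_def induce_def)

lemma embeds_induce:
  assumes "embeds f G H" "W \<subseteq> verts G"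
  shows "embeds f (induce G W) H"
  using assms unfolding embeds_def induce_def
  by (auto simp: subset_iff elim: inj_on_subset)

lemma fin_graphs_simple: "G \<in> fin_graphs \<Longrightarrow> simple_graph G"
  by (simp add: fin_graphs_def)

text \<open>Additivity handles only two summands, while \<open>I\<close> may be infinite; strong
  induction on the number of vertices bridges this. Choose a summand that \<open>K\<close> meets:
  the part of \<open>K\<close> inside it is in \<open>P\<close> by \<open>fin\<close>, the rest is
  smaller, and no edge joins the two.\<close>

lemma finite_subgraph_of_family_union:
  assumes P: "graph_property P" and add: "additive P" and her: "induced_hereditary P"
    and ne: "P \<noteq> {}"
    and F: "\<And>i. i \<in> I \<Longrightarrow> simple_graph (F i)"
    and fin: "\<And>i K. i \<in> I \<Longrightarrow> K \<in> fin_graphs \<Longrightarrow> K \<le>\<^sub>g F i \<Longrightarrow> K \<in> P"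
    and K: "K \<in> fin_graphs" "K \<le>\<^sub>g family_union I F"
  shows "K \<in> P"
  using K
proof (induction "card (verts K)" arbitrary: K rule: less_induct)
  case less
  let ?U = "family_union I F"
  have sU: "simple_graph ?U" and sK: "simple_graph K"
    using F less.prems by (auto simp: simple_family_union fin_graphs_simple)
  obtain f where f: "embeds f K ?U" using less.prems sU sK by (auto simp: induced_le_iff_embeds)
  show ?case
  proof (cases "verts K = {}")
    case True
    \<comment> \<open>The graph without vertices embeds into any member of \<open>P\<close>, so
      heredity and nonemptiness settle the base case.\<close>
    obtain G where G: "G \<in> P" using ne by auto
    then have "simple_graph G" using P by (auto simp: graph_property_def fin_graphs_simple)
    moreover have "embeds id K G" using True by (simp add: embeds_def)
    ultimately show ?thesis
      using her G less.prems sK unfolding induced_hereditary_def by (metis induced_le_iff_embeds)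
  next
    case False
    then obtain v where v: "v \<in> verts K" by auto
    define i where "i = fst (f v)"
    define A where "A = {x \<in> verts K. fst (f x) = i}"
    define B where "B = {x \<in> verts K. fst (f x) \<noteq> i}"
    have iI: "i \<in> I" using f v by (auto simp: embeds_def i_def)
    have finK: "finite (verts K)" using less.prems by (simp add: fin_graphs_def)
    have fg: "induce K A \<in> fin_graphs" "induce K B \<in> fin_graphs"
      using simple_induce[OF sK] finK by (auto simp: fin_graphs_def induce_def A_def B_def)
    have AB: "A \<subseteq> verts K" "B \<subseteq> verts K" "v \<notin> B" by (auto simp: A_def B_def i_def)
    have "embeds (snd \<circ> f) (induce K A) (F i)"
    proof -
      \<comment> \<open>On \<open>A\<close> the first component of \<open>f\<close> is constantly
        \<open>i\<close>, so the second component inherits injectivity.\<close>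
      have "inj_on (snd \<circ> f) A"
        using f unfolding A_def embeds_def inj_on_def by (auto simp: prod_eq_iff)
      then show ?thesis using f iI by (auto simp: embeds_def A_def induce_def image_subset_iff)
    qed
    then have AP: "induce K A \<in> P"
      using fin[OF iI fg(1)] F[OF iI] simple_induce[OF sK] by (auto simp: induced_le_iff_embeds)
    have "card B < card (verts K)" using AB v finK by (intro psubset_card_mono) auto
    moreover have "induce K B \<le>\<^sub>g ?U"
      using embeds_induce[OF f AB(2)] sU simple_induce[OF sK] by (auto simp: induced_le_iff_embeds)
    ultimately have BP: "induce K B \<in> P" using less.hyps fg(2) by (simp add: induce_def)
    let ?D = "disjoint_union (induce K A) (induce K B)"
    let ?g = "\<lambda>x. if x \<in> A then Inl x else Inr x"
    have BA: "x \<in> B \<longleftrightarrow> x \<notin> A" if "x \<in> verts K" for x using that by (auto simp: A_def B_def)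
    \<comment> \<open>Here \<open>f\<close> puts \<open>x\<close> and \<open>y\<close> into
      different summands, and every edge of the union stays within one.\<close>
    have cross: "{x, y} \<notin> edges K" "{y, x} \<notin> edges K" if "x \<in> A" "y \<in> verts K" "y \<notin> A" for x y
      using f that by (auto simp: embeds_def A_def)
    have vD: "verts ?D = A <+> B" by (simp add: disjoint_union_def induce_def)
    have "embeds ?g K ?D"
      unfolding embeds_def vD
    proof (intro conjI ballI)
      show "inj_on ?g (verts K)" by (auto simp: inj_on_def)
      show "?g ` verts K \<subseteq> A <+> B" using BA by auto
      fix x y assume "x \<in> verts K" "y \<in> verts K"
      then show "{x, y} \<in> edges K \<longleftrightarrow> {?g x, ?g y} \<in> edges ?D"
        using BA cross by (cases "x \<in> A"; cases "y \<in> A") (auto simp: induce_def)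
    qed
    moreover have "?g ` verts K = verts ?D"
      unfolding vD using BA AB by (auto simp: image_iff)
    ultimately have "K \<cong>\<^sub>g ?D"
      using sK simple_disjoint_union[OF simple_induce[OF sK] simple_induce[OF sK]]
      by (rule graph_isoI_embeds)
    then show ?thesis using add AP BP less.prems(1) unfolding additive_def by blast
  qed
qed

text \<open>Two families matter later: a constant one, giving countably many copies of a generating
  graph, and an enumeration of all of \<open>P\<close>.\<close>

lemma generating_family_union:
  assumes P: "graph_property P" "additive P" "induced_hereditary P" "P \<noteq> {}"
    and F: "\<And>i. i \<in> I \<Longrightarrow> simple_graph (F i)"
    and fin: "\<And>i K. i \<in> I \<Longrightarrow> K \<in> fin_graphs \<Longrightarrow> K \<le>\<^sub>g F i \<Longrightarrow> K \<in> P"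
    and gen: "\<And>K. K \<in> P \<Longrightarrow> \<exists>i\<in>I. K \<le>\<^sub>g F i"
  shows "generating_graph P (family_union I F)"
proof -
  have sU: "simple_graph (family_union I F)" using F by (rule simple_family_union)
  have "K \<in> fin_graphs \<and> K \<le>\<^sub>g family_union I F" if K: "K \<in> P" for K
  proof -
    obtain i where i: "i \<in> I" "K \<le>\<^sub>g F i" using gen[OF K] by auto
    have "K \<in> fin_graphs" using K P(1) by (auto simp: graph_property_def)
    with i show ?thesis
      using induced_le_trans[OF i(2) member_le_family_union[OF i(1), of F]] F sU fin_graphs_simple
      by blast
  qed
  moreover have "K \<in> P" if "K \<in> fin_graphs" "K \<le>\<^sub>g family_union I F" for K
    using P F fin that by (rule finite_subgraph_of_family_union)
  ultimately show ?thesis using sU unfolding generating_graph_def by blast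
qed

text \<open>Summand \<open>i\<close> of copy \<open>b\<close> is sent to summand
  \<open>2 * i + b\<close>. Parity recovers \<open>b\<close> and halving recovers
  \<open>i\<close>.\<close>

lemma double_omega_le_omega:
  fixes G :: "'a ugraph"
  assumes G: "simple_graph G"
  defines "U \<equiv> family_union (UNIV :: nat set) (\<lambda>_. G)"
  shows "copies 2 U \<le>\<^sub>g U"
proof -
  have sU: "simple_graph U" unfolding U_def by (rule simple_family_union) (rule G)
  have parity: "b = b' \<and> i = i'" if "2 * i + b = 2 * i' + b'" "b < 2" "b' < 2" for b b' i i' :: nat
    using that by presburger
  have "embeds (\<lambda>(b, i, x). (2 * i + b, x)) (copies 2 U) U"
    unfolding embeds_def copies_eq_family_union U_def
    by (auto simp: inj_on_def dest: parity)
  then show ?thesis using sU simple_copies[OF sU] by (auto simp: induced_le_iff_embeds)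
qed

text \<open>The union \<open>U\<close> of countably many copies has vertex type
  \<open>nat \<times> 'a\<close>, and \<open>h\<close> carries it to \<open>'v\<close>. Keeping
  \<open>'v\<close> separate from \<open>'a\<close> lets the lemma serve both to construct a first
  generating graph and to extend a given one on its own vertex type.\<close>

lemma generating_graph_extends_to_doubling:
  fixes h :: "nat \<times> 'a \<Rightarrow> 'v"
  assumes P: "graph_property P" "additive P" "induced_hereditary P" "P \<noteq> {}"
    and G: "generating_graph P (G :: 'a ugraph)" and h: "inj h"
  shows "\<exists>H :: 'v ugraph. generating_graph P H \<and> G \<le>\<^sub>g H \<and> copies 2 H \<le>\<^sub>g H"
proof -
  define U where "U = family_union (UNIV :: nat set) (\<lambda>_. G)"
  define H where "H = relabel h U"
  have sG: "simple_graph G" using G by (simp add: generating_graph_def)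
  have U: "generating_graph P U"
    unfolding U_def using G by (intro generating_family_union P) (auto simp: generating_graph_def)
  then have sU: "simple_graph U" by (simp add: generating_graph_def)
  have hU: "inj_on h (verts U)" using h inj_on_subset by blast
  have sH: "simple_graph H" unfolding H_def using simple_relabel sU hU .
  have UH: "U \<le>\<^sub>g H" "H \<le>\<^sub>g U"
    using relabel_iso[OF sU hU] sU sH by (auto simp: H_def graph_iso_imp_induced_le)
  \<comment> \<open>\<open>U\<close> and \<open>H\<close> embed into each other, so they have the
    same finite induced subgraphs.\<close>
  have "K \<le>\<^sub>g U \<longleftrightarrow> K \<le>\<^sub>g H" if "K \<in> fin_graphs" for K
    using UH sU sH fin_graphs_simple[OF that] by (metis induced_le_trans)
  then have "generating_graph P H" using U sH by (auto simp: generating_graph_def)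
  moreover have "G \<le>\<^sub>g U"
    unfolding U_def using member_le_family_union[of _ UNIV "\<lambda>_. G"] sG by auto
  then have "G \<le>\<^sub>g H" using UH(1) sG sU sH by (rule induced_le_trans)
  moreover have "copies 2 H \<le>\<^sub>g U"
    using copies_mono[OF UH(2) sH sU] double_omega_le_omega[OF sG]
      simple_copies[OF sH] simple_copies[OF sU] sU
    unfolding U_def[symmetric] by (rule induced_le_trans)
  then have "copies 2 H \<le>\<^sub>g H" using UH(1) simple_copies[OF sH] sU sH by (rule induced_le_trans)
  ultimately show ?thesis by blast
qed

section \<open>Countability, and upper bounds inside an additive property\<close>

lemma countable_fin_graphs: "countable fin_graphs"
proof -
  \<comment> \<open>A finite graph on \<open>nat\<close> is determined by a finite set of numbers
    and a finite set of such sets; there are countably many of each.\<close>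
  let ?S = "Collect finite :: nat set set"
  let ?T = "{E. finite E \<and> E \<subseteq> ?S}"
  have "countable (?S \<times> ?T)"
    by (intro countable_SIGMA countable_Collect_finite countable_Collect_finite_subset)
  then have "countable ((\<lambda>(V, E). \<lparr>verts = V, edges = E\<rparr>) ` (?S \<times> ?T))"
    by (rule countable_image)
  moreover have "G \<in> (\<lambda>(V, E). \<lparr>verts = V, edges = E\<rparr>) ` (?S \<times> ?T)" if "G \<in> fin_graphs" for G
  proof -
    have fin: "finite (verts G)" and sub: "edges G \<subseteq> Pow (verts G)"
      using that by (auto simp: fin_graphs_def simple_graph_def)
    then have "finite (edges G)" using finite_subset by blast
    moreover have "edges G \<subseteq> ?S" using fin sub finite_subset by blast
    ultimately show ?thesis using fin by (intro image_eqI[of _ _ "(verts G, edges G)"]) auto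
  qed
  ultimately show ?thesis by (meson countable_subset subsetI)
qed

lemma graph_property_enumeration:
  assumes "graph_property P" "P \<noteq> {}"
  obtains g :: "nat \<Rightarrow> nat ugraph" where "range g = P"
proof -
  have "countable P"
    using assms(1) countable_subset[OF _ countable_fin_graphs] by (simp add: graph_property_def)
  then show thesis using that range_from_nat_into[OF assms(2)] by blast
qed

lemma additive_obtain_union:
  assumes P: "graph_property P" "additive P" and "G \<in> P" "H \<in> P"
  obtains K where "K \<in> P" "disjoint_union G H \<le>\<^sub>g K"
proof -
  have GH: "G \<in> fin_graphs" "H \<in> fin_graphs" using assms by (auto simp: graph_property_def)
  then have s: "simple_graph (disjoint_union G H)" "finite (verts (disjoint_union G H))"
    by (auto simp: fin_graphs_def simple_disjoint_union verts_disjoint_union)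
  obtain K where K: "K \<in> fin_graphs" "K \<cong>\<^sub>g disjoint_union G H" "disjoint_union G H \<cong>\<^sub>g K"
    using finite_graph_on_nat[OF s] .
  then have "K \<in> P" using assms unfolding additive_def by blast
  with K that show thesis by (simp add: graph_iso_imp_induced_le fin_graphs_simple)
qed

text \<open>Two unions suffice: \<open>M\<close> contains \<open>L\<close> joined with itself, and
  \<open>K\<close> contains \<open>M\<close> joined with \<open>G\<close>.\<close>

lemma additive_obtain_double:
  assumes P: "graph_property P" "additive P" and L: "L \<in> P" and G: "G \<in> P"
  obtains K where "K \<in> P" "copies 2 L \<le>\<^sub>g K" "G \<le>\<^sub>g K"
proof -
  have s: "simple_graph X" if "X \<in> P" for X
    using that P(1) by (auto simp: graph_property_def fin_graphs_simple)
  obtain M where M: "M \<in> P" "disjoint_union L L \<le>\<^sub>g M" using additive_obtain_union P L by blast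
  obtain K where K: "K \<in> P" "disjoint_union M G \<le>\<^sub>g K" using additive_obtain_union P M G by blast
  note simps = s[OF L] s[OF G] s[OF M(1)] s[OF K(1)] simple_copies[OF s[OF L]]
    simple_disjoint_union[OF s[OF L] s[OF L]] simple_disjoint_union[OF s[OF M(1)] s[OF G]]
  have "M \<le>\<^sub>g K" "G \<le>\<^sub>g K"
    using summands_le_disjoint_union[OF s[OF M(1)] s[OF G]] K(2) simps induced_le_trans by blast+
  moreover have "copies 2 L \<le>\<^sub>g M"
    using copies_2_le_disjoint_union[OF s[OF L]] M(2) simps induced_le_trans by blast
  ultimately show thesis using that K(1) simps induced_le_trans by blast
qed

section \<open>Heredity, additivity and generating sets\<close>

lemma generating_set_imp_hereditary:
  assumes P: "graph_property P" and gen: "generating_set P \<G>"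
  shows "induced_hereditary P"
  unfolding induced_hereditary_def
proof (intro ballI impI)
  fix H G assume H: "H \<in> P" and G: "G \<in> fin_graphs" and le: "G \<le>\<^sub>g H"
  \<comment> \<open>A generating set controls only the subgraphs of its own elements, so
    \<open>G\<close> has to be placed inside a generator above \<open>H\<close>.\<close>
  obtain K where K: "K \<in> \<G>" "H \<le>\<^sub>g K" using gen H by (auto simp: generating_set_def)
  have "H \<in> fin_graphs" "K \<in> fin_graphs"
    using P gen H K by (auto simp: graph_property_def generating_set_def)
  then have "G \<le>\<^sub>g K" using induced_le_trans[OF le K(2)] G fin_graphs_simple by blast
  then show "G \<in> P" using gen K G unfolding generating_set_def by blast
qed

text \<open>The common criterion behind all three converses: the union of \<open>G\<close> and
  \<open>H\<close> embeds into \<open>copies 2 K\<close>, hence into \<open>M\<close>, whose finite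
  induced subgraphs are in \<open>P\<close>. The vertex types of \<open>K\<close> and
  \<open>M\<close> are free, so infinite generating graphs are covered as well.\<close>

lemma additiveI_double:
  fixes P :: "nat ugraph set"
  assumes P: "graph_property P"
    and dbl: "\<And>G H. G \<in> P \<Longrightarrow> H \<in> P \<Longrightarrow> \<exists>(K :: 'a ugraph) (M :: 'b ugraph).
      simple_graph K \<and> simple_graph M \<and> G \<le>\<^sub>g K \<and> H \<le>\<^sub>g K \<and> copies 2 K \<le>\<^sub>g M \<and>
      (\<forall>X\<in>fin_graphs. X \<le>\<^sub>g M \<longrightarrow> X \<in> P)"
  shows "additive P"
  unfolding additive_def
proof (intro ballI impI)
  fix G H X assume G: "G \<in> P" and H: "H \<in> P" and X: "X \<in> fin_graphs"
    and iso: "X \<cong>\<^sub>g disjoint_union G H"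
  have s: "simple_graph G" "simple_graph H" "simple_graph X"
    using G H X P by (auto simp: graph_property_def fin_graphs_simple)
  obtain K :: "'a ugraph" and M :: "'b ugraph" where K: "simple_graph K" "simple_graph M"
    "G \<le>\<^sub>g K" "H \<le>\<^sub>g K" "copies 2 K \<le>\<^sub>g M" and cl: "\<forall>X\<in>fin_graphs. X \<le>\<^sub>g M \<longrightarrow> X \<in> P"
    using dbl[OF G H] by blast
  note sD = simple_disjoint_union[OF s(1,2)]
  have "X \<le>\<^sub>g disjoint_union G H" using graph_iso_imp_induced_le[OF iso sD] .
  then have "X \<le>\<^sub>g copies 2 K"
    using disjoint_union_le_copies[OF K(3,4) s(1,2) K(1)] s(3) sD simple_copies[OF K(1)]
    by (rule induced_le_trans)
  then have "X \<le>\<^sub>g M" using K(5) s(3) simple_copies[OF K(1)] K(2) by (rule induced_le_trans)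
  with cl X show "X \<in> P" by blast
qed

text \<open>Some member of \<open>P\<close> contains both \<open>G\<close> and two copies of
  \<open>L\<close>; any generator above it survives the restriction and still contains
  \<open>G\<close>.\<close>

lemma generating_set_containing_two:
  assumes P: "graph_property P" "additive P" and L: "L \<in> P" and gen: "generating_set P \<G>"
  shows "generating_set P (containing_two \<G> L)"
proof -
  have s: "simple_graph X" if "X \<in> P" for X
    using that P(1) by (auto simp: graph_property_def fin_graphs_simple)
  have "\<exists>H\<in>containing_two \<G> L. G \<le>\<^sub>g H" if G: "G \<in> P" for G
  proof -
    obtain K where K: "K \<in> P" "copies 2 L \<le>\<^sub>g K" "G \<le>\<^sub>g K"
      using additive_obtain_double[OF P L G] .
    obtain H where H: "H \<in> \<G>" "K \<le>\<^sub>g H" using gen K by (auto simp: generating_set_def)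
    then have "H \<in> P" using gen by (auto simp: generating_set_def)
    then have "copies 2 L \<le>\<^sub>g H" "G \<le>\<^sub>g H"
      using K H s L G simple_copies induced_le_trans by blast+
    with H show ?thesis by (auto simp: containing_two_def)
  qed
  then show ?thesis using gen by (auto simp: generating_set_def containing_two_def)
qed

lemma hereditary_generates_itself:
  assumes "graph_property P" "induced_hereditary P"
  shows "generating_set P P"
  unfolding generating_set_def
proof (intro conjI ballI impI)
  fix G assume "G \<in> P"
  then show "\<exists>H\<in>P. G \<le>\<^sub>g H"
    using assms(1) induced_le_refl fin_graphs_simple unfolding graph_property_def by blast
qed (use assms(2) in \<open>auto simp: induced_hereditary_def\<close>)

text \<open>The restriction is applied twice. Taking \<open>L\<close> to be \<open>G\<close> yields
  a generator \<open>K\<close> above both \<open>G\<close> and \<open>H\<close>; taking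
  \<open>L\<close> to be \<open>K\<close> then yields a generator \<open>M\<close> above two copies
  of \<open>K\<close>.\<close>

lemma additive_if_containing_two:
  assumes P: "graph_property P" and gen: "generating_set P \<G>"
    and two: "\<And>L \<G>. L \<in> P \<Longrightarrow> generating_set P \<G> \<Longrightarrow> generating_set P (containing_two \<G> L)"
  shows "additive P"
proof (rule additiveI_double[OF P])
  fix G H assume G: "G \<in> P" and H: "H \<in> P"
  have s: "simple_graph X" if "X \<in> P" for X
    using that P by (auto simp: graph_property_def fin_graphs_simple)
  obtain K where K: "K \<in> containing_two \<G> G" "H \<le>\<^sub>g K"
    using two[OF G gen] H by (auto simp: generating_set_def)
  have KP: "K \<in> P" using K gen by (auto simp: containing_two_def generating_set_def)
  have "G \<le>\<^sub>g copies 2 G" using s[OF G] by (rule le_copies) simp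
  moreover have "copies 2 G \<le>\<^sub>g K" using K by (simp add: containing_two_def)
  ultimately have GK: "G \<le>\<^sub>g K"
    using s[OF G] simple_copies[OF s[OF G]] s[OF KP] by (rule induced_le_trans)
  \<comment> \<open>Only nonemptiness of the restricted generating set is wanted here; covering
    \<open>H\<close>, a known member of \<open>P\<close>, provides it.\<close>
  obtain M where M: "M \<in> containing_two \<G> K"
    using two[OF KP gen] H by (auto simp: generating_set_def)
  then have "M \<in> \<G>" "M \<in> P" "copies 2 K \<le>\<^sub>g M"
    using gen by (auto simp: containing_two_def generating_set_def)
  moreover have "\<forall>X\<in>fin_graphs. X \<le>\<^sub>g M \<longrightarrow> X \<in> P"
    using gen \<open>M \<in> \<G>\<close> by (simp add: generating_set_def)
  ultimately show "\<exists>(K :: nat ugraph) (M :: nat ugraph).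
      simple_graph K \<and> simple_graph M \<and> G \<le>\<^sub>g K \<and> H \<le>\<^sub>g K \<and>
      copies 2 K \<le>\<^sub>g M \<and> (\<forall>X\<in>fin_graphs. X \<le>\<^sub>g M \<longrightarrow> X \<in> P)"
    using s KP GK K(2) by blast
qed

section \<open>Ordered generating sets with doubling\<close>

lemma induced_le_chain:
  assumes "\<And>i. simple_graph (H i)" "\<And>i. H i \<le>\<^sub>g H (Suc i)" "i \<le> j"
  shows "H i \<le>\<^sub>g H j"
  using assms(3)
proof (induction j rule: dec_induct)
  case base
  then show ?case using assms(1) induced_le_refl by blast
next
  case (step n)
  then show ?case using induced_le_trans assms(1,2) by blast
qed

lemma additive_if_doubling_chain:
  assumes P: "graph_property P" and gen: "generating_set P (range H)"
    and chain: "\<And>i. H i \<le>\<^sub>g H (Suc i)" and dbl: "\<And>i. copies 2 (H i) \<le>\<^sub>g H (Suc i)"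
  shows "additive P"
proof (rule additiveI_double[OF P])
  fix G G' assume G: "G \<in> P" and G': "G' \<in> P"
  have s: "simple_graph X" if "X \<in> P" for X
    using that P by (auto simp: graph_property_def fin_graphs_simple)
  have HP: "H i \<in> P" for i using gen by (auto simp: generating_set_def)
  have "\<exists>i. X \<le>\<^sub>g H i" if "X \<in> P" for X using gen that by (auto simp: generating_set_def)
  then obtain i j where ij: "G \<le>\<^sub>g H i" "G' \<le>\<^sub>g H j" using G G' by blast
  \<comment> \<open>The order brings both graphs under one term, and the next term contains two
    copies of that term.\<close>
  let ?m = "max i j"
  have "H i \<le>\<^sub>g H ?m" "H j \<le>\<^sub>g H ?m"
    using induced_le_chain[of H, OF s[OF HP] chain] by auto
  then have "G \<le>\<^sub>g H ?m" "G' \<le>\<^sub>g H ?m" using ij s G G' HP induced_le_trans by blast+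
  moreover have "\<forall>X\<in>fin_graphs. X \<le>\<^sub>g H (Suc ?m) \<longrightarrow> X \<in> P"
    using gen by (simp add: generating_set_def)
  ultimately show "\<exists>(K :: nat ugraph) (M :: nat ugraph).
      simple_graph K \<and> simple_graph M \<and> G \<le>\<^sub>g K \<and> G' \<le>\<^sub>g K \<and>
      copies 2 K \<le>\<^sub>g M \<and> (\<forall>X\<in>fin_graphs. X \<le>\<^sub>g M \<longrightarrow> X \<in> P)"
    using s HP dbl by blast
qed

text \<open>Once a term has a vertex, each step at least doubles the number of vertices, so these
  numbers are strictly increasing and tell the isomorphism types apart.\<close>

lemma infinite_iso_types_doubling_chain:
  assumes fg: "\<And>i. H i \<in> fin_graphs" and chain: "\<And>i. H i \<le>\<^sub>g H (Suc i)"
    and dbl: "\<And>i. copies 2 (H i) \<le>\<^sub>g H (Suc i)" and ne: "verts (H k) \<noteq> {}"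
  shows "infinite (iso_types (range H))"
proof -
  \<comment> \<open>Counting starts at \<open>k\<close> because earlier terms may be empty, and
    doubling does not enlarge an empty graph.\<close>
  define c where "c n = card (verts (H (k + n)))" for n
  have s: "simple_graph (H i)" and f: "finite (verts (H i))" for i
    using fg[of i] by (auto simp: fin_graphs_def)
  have "0 < card (verts (H k))" using ne f by (simp add: card_gt_0_iff)
  moreover have "card (verts (H k)) \<le> c n" for n
    unfolding c_def using induced_le_card[OF induced_le_chain[of H, OF s chain] s s f] by simp
  ultimately have pos: "0 < c n" for n by (meson less_le_trans)
  have two: "2 * c n \<le> c (Suc n)" for n
    using induced_le_card[OF dbl simple_copies[OF s] s f, of "k + n"]
    by (simp add: c_def copies_def card_cartesian_product)
  have "c n < c (Suc n)" for n using pos[of n] two[of n] by linarith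
  then have inj_c: "inj c" by (simp add: strict_mono_Suc_iff strict_mono_imp_inj_on)
  let ?t = "\<lambda>n. {K \<in> fin_graphs. K \<cong>\<^sub>g H (k + n)}"
  have "inj ?t"
  proof (rule injI)
    fix m n assume "?t m = ?t n"
    then have "H (k + m) \<in> ?t n" using fg graph_iso_refl by blast
    then have "c m = c n" by (simp add: c_def graph_iso_card)
    then show "m = n" using inj_c by (simp add: inj_eq)
  qed
  then have "infinite (range ?t)" by (rule range_inj_infinite)
  moreover have "range ?t \<subseteq> iso_types (range H)" by (auto simp: iso_types_def)
  ultimately show ?thesis using finite_subset by blast
qed

text \<open>Dependent choice: \<open>H (Suc n)\<close> is taken above both \<open>g (Suc n)\<close>
  and two copies of \<open>H n\<close>, where \<open>g\<close> enumerates \<open>P\<close>. The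
  first demand makes the chain generating, the second makes it ordered and doubling.\<close>

lemma additive_hereditary_obtain_chain:
  assumes P: "graph_property P" "additive P" "induced_hereditary P"
    and nontrivial: "\<exists>G\<in>P. verts G \<noteq> {}"
  shows "\<exists>H :: nat \<Rightarrow> nat ugraph. generating_set P (range H) \<and> infinite (iso_types (range H)) \<and>
    (\<forall>i. H i \<le>\<^sub>g H (Suc i)) \<and> (\<forall>i. copies 2 (H i) \<le>\<^sub>g H (Suc i))"
proof -
  have fg: "X \<in> fin_graphs" if "X \<in> P" for X using that P(1) by (auto simp: graph_property_def)
  note s = fin_graphs_simple[OF fg]
  have ne: "P \<noteq> {}" using nontrivial by auto
  obtain g :: "nat \<Rightarrow> nat ugraph" where g: "range g = P"
    using graph_property_enumeration[OF P(1) ne] .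
  have gP: "g n \<in> P" for n using g by auto
  have "\<exists>H. \<forall>n. (H n \<in> P \<and> g n \<le>\<^sub>g H n) \<and> copies 2 (H n) \<le>\<^sub>g H (Suc n)"
  proof (rule dependent_nat_choice)
    show "\<exists>K. K \<in> P \<and> g 0 \<le>\<^sub>g K" using gP s induced_le_refl by blast
    show "\<exists>K'. (K' \<in> P \<and> g (Suc n) \<le>\<^sub>g K') \<and> copies 2 K \<le>\<^sub>g K'" if "K \<in> P \<and> g n \<le>\<^sub>g K" for K n
      using additive_obtain_double[OF P(1,2) _ gP] that by metis
  qed
  then obtain H where HP: "\<And>n. H n \<in> P" and gH: "\<And>n. g n \<le>\<^sub>g H n"
    and dbl: "\<And>n. copies 2 (H n) \<le>\<^sub>g H (Suc n)" by blast
  have chain: "H i \<le>\<^sub>g H (Suc i)" for i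
    using le_copies[of "H i" 2] dbl[of i] s[OF HP] simple_copies induced_le_trans
    by (metis zero_less_numeral)
  have "\<exists>K\<in>range H. G \<le>\<^sub>g K" if "G \<in> P" for G using that g gH by (metis rangeE rangeI)
  then have gen: "generating_set P (range H)"
    using HP P(3) unfolding generating_set_def induced_hereditary_def by blast
  obtain k where k: "verts (g k) \<noteq> {}" using nontrivial g by auto
  then have "verts (H k) \<noteq> {}"
    using gH[of k] s[OF gP] s[OF HP] by (auto simp: induced_le_iff_embeds embeds_def)
  then have "infinite (iso_types (range H))"
    using infinite_iso_types_doubling_chain[of H k, OF fg[OF HP] chain dbl] by blast
  with gen chain dbl show ?thesis by blast
qed

section \<open>Generating graphs that absorb their double, and the equivalences\<close>

lemma doubling_generating_graph_imp:
  fixes H :: "'a ugraph"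
  assumes P: "graph_property P" and H: "generating_graph P H" "copies 2 H \<le>\<^sub>g H"
  shows "additive P" "induced_hereditary P"
proof -
  have sH: "simple_graph H" and PH: "\<And>G. G \<in> P \<longleftrightarrow> G \<in> fin_graphs \<and> G \<le>\<^sub>g H"
    using H(1) by (auto simp: generating_graph_def)
  \<comment> \<open>In the criterion, \<open>H\<close> plays both \<open>K\<close> and
    \<open>M\<close>.\<close>
  show "additive P" using sH PH H(2) by (intro additiveI_double[OF P]) blast
  show "induced_hereditary P"
    unfolding induced_hereditary_def
    using sH fin_graphs_simple PH induced_le_trans[where K = H] by metis
qed

text \<open>By cardinal arithmetic, multiplying an infinite set by a countable one does not increase
  its cardinality. This makes room in \<open>'v\<close> for countably many copies of a graph that
  may already use every element of \<open>'v\<close>.\<close>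

lemma infinite_obtain_inj_nat_times:
  assumes "infinite (UNIV :: 'v set)"
  obtains h :: "nat \<times> 'v \<Rightarrow> 'v" where "inj h"
proof -
  let ?N = "UNIV :: nat set" and ?V = "UNIV :: 'v set"
  have "(card_of ?N, card_of ?V) \<in> ordLeq"
    using assms by (simp add: infinite_iff_card_of_nat)
  then have "(card_of (?N \<times> ?V), card_of ?V) \<in> ordLeq"
    using ordIso_imp_ordLeq card_of_Times_infinite_simps(3)[OF assms UNIV_not_empty] by blast
  then obtain h :: "nat \<times> 'v \<Rightarrow> 'v" where "inj_on h (?N \<times> ?V)"
    by (auto simp: card_of_ordLeq[symmetric])
  then show thesis using that by simp
qed

text \<open>\<open>nontrivial\<close> excludes the empty property and the property of the graph
  without vertices: both are additive and induced-hereditary, but neither has a generating set with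
  infinitely many isomorphism types. \<open>vertex_supply\<close> is there because an additive
  property with a nonempty graph has arbitrarily large members, so its generating graphs are
  infinite.\<close>

theorem theorem4p3:
  fixes P :: "nat ugraph set"
  assumes property: "graph_property P"
    and nontrivial: "\<exists>G\<in>P. verts G \<noteq> {}"
    and vertex_supply: "infinite (UNIV :: 'v set)"
  shows "(additive P \<and> induced_hereditary P
      \<longleftrightarrow> (\<exists>\<G>. generating_set P \<G>) \<and>
          (\<forall>L\<in>P. \<forall>\<G>. generating_set P \<G> \<longrightarrow> generating_set P (containing_two \<G> L)))
    \<and> (additive P \<and> induced_hereditary P
      \<longleftrightarrow> (\<exists>H :: nat \<Rightarrow> nat ugraph.
            generating_set P (range H) \<and> infinite (iso_types (range H)) \<and>
            (\<forall>i. H i \<le>\<^sub>g H (Suc i)) \<and> (\<forall>i. copies 2 (H i) \<le>\<^sub>g H (Suc i))))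
    \<and> (additive P \<and> induced_hereditary P
      \<longleftrightarrow> (\<exists>H :: 'v ugraph. generating_graph P H \<and> copies 2 H \<le>\<^sub>g H) \<and>
          (\<forall>G :: 'v ugraph. generating_graph P G \<longrightarrow>
            (\<exists>H :: 'v ugraph. generating_graph P H \<and> G \<le>\<^sub>g H \<and> copies 2 H \<le>\<^sub>g H)))"
proof -
  have ne: "P \<noteq> {}" using nontrivial by auto
  let ?A = "additive P \<and> induced_hereditary P"
  have B: "?A \<longleftrightarrow> (\<exists>\<G>. generating_set P \<G>) \<and>
      (\<forall>L\<in>P. \<forall>\<G>. generating_set P \<G> \<longrightarrow> generating_set P (containing_two \<G> L))"
    using generating_set_containing_two[OF property] hereditary_generates_itself[OF property]
      generating_set_imp_hereditary[OF property] additive_if_containing_two[OF property] by metis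
  have C: "?A \<longleftrightarrow> (\<exists>H :: nat \<Rightarrow> nat ugraph.
      generating_set P (range H) \<and> infinite (iso_types (range H)) \<and>
      (\<forall>i. H i \<le>\<^sub>g H (Suc i)) \<and> (\<forall>i. copies 2 (H i) \<le>\<^sub>g H (Suc i)))"
    using additive_hereditary_obtain_chain[OF property _ _ nontrivial]
      generating_set_imp_hereditary[OF property] additive_if_doubling_chain[OF property] by blast
  have "\<exists>H :: 'v ugraph. generating_graph P H \<and> copies 2 H \<le>\<^sub>g H" if A: ?A
  proof -
    have fg: "X \<in> fin_graphs" if "X \<in> P" for X
      using that property by (auto simp: graph_property_def)
    obtain g :: "nat \<Rightarrow> nat ugraph" where g: "range g = P"
      using graph_property_enumeration[OF property ne] .
    \<comment> \<open>The first generating graph is the disjoint union of all members of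
      \<open>P\<close>, with repetitions allowed.\<close>
    have "generating_graph P (family_union UNIV g)"
    proof (rule generating_family_union)
      show "simple_graph (g i)" for i using g fg fin_graphs_simple by blast
      show "K \<in> P" if "K \<in> fin_graphs" "K \<le>\<^sub>g g i" for i K
        using that A g unfolding induced_hereditary_def by blast
      show "\<exists>i\<in>UNIV. K \<le>\<^sub>g g i" if "K \<in> P" for K
        using that g fg fin_graphs_simple induced_le_refl by (metis UNIV_I rangeE)
    qed (use A property ne in auto)
    moreover obtain h :: "nat \<Rightarrow> 'v" where "inj h"
      using infinite_countable_subset[OF vertex_supply] by auto
    \<comment> \<open>That union has vertices in \<open>nat \<times> nat\<close>, and taking
      countably many copies adds another index; the triples are coded as numbers and then mapped
      into \<open>'v\<close>.\<close>
    then have "inj (h \<circ> (to_nat :: nat \<times> nat \<times> nat \<Rightarrow> nat))" by (simp add: inj_compose)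
    ultimately show ?thesis
      using generating_graph_extends_to_doubling[OF property] A ne by blast
  qed
  moreover have "\<exists>H :: 'v ugraph. generating_graph P H \<and> G \<le>\<^sub>g H \<and> copies 2 H \<le>\<^sub>g H"
    if A: ?A and G: "generating_graph P G" for G :: "'v ugraph"
  proof -
    obtain h :: "nat \<times> 'v \<Rightarrow> 'v" where "inj h"
      using infinite_obtain_inj_nat_times[OF vertex_supply] .
    then show ?thesis using generating_graph_extends_to_doubling[OF property] A ne G by blast
  qed
  ultimately have D: "?A \<longleftrightarrow> (\<exists>H :: 'v ugraph. generating_graph P H \<and> copies 2 H \<le>\<^sub>g H) \<and>
      (\<forall>G :: 'v ugraph. generating_graph P G \<longrightarrow>
        (\<exists>H :: 'v ugraph. generating_graph P H \<and> G \<le>\<^sub>g H \<and> copies 2 H \<le>\<^sub>g H))"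
    using doubling_generating_graph_imp[OF property] by blast
  from B C D show ?thesis by (intro conjI)
qed

end
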